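(* Let $\mu:\mathcal{C}\to\mathbb{R}_0^+$ and $\nu:\mathcal{E}\to\mathbb{R}_0^+$ be set functions with $\mu(\emptyset)=\nu(\emptyset)=0$. Let $T$ be a nonempty set, $\varphi:S\to T$ a function, $\mathcal{A}=\{E\subseteq T:\varphi^{-1}(E)\in\mathcal{C}\}$, and let $\mu\varphi^{-1}:\mathcal{A}\to\mathbb{R}_0^+$ be the set function $(\mu\varphi^{-1})(E)=\mu(\varphi^{-1}(E))$, $E\in\mathcal{A}$. Let $g:T\to\mathbb{R}_0^+$ be a function. Then $g\in G_{RL}(\nu,\mu\varphi^{-1},T)$ if and only if $g\circ\varphi\in G_{RL}(\nu,\mu,S)$. In this case, $$\int_T^{*} g\,d(\nu,\mu\varphi^{-1})=\int_S^{*}(g\circ\varphi)\,d(\nu,\mu).$$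
   Context: $\mathbb{R}_0^+=[0,\infty)$. $S$ is a nonempty, at least countable set, $\mathcal{C}$ is a $\sigma$-algebra of subsets of $S$, and $\mathcal{E}$ is a $\sigma$-algebra of subsets of $\mathbb{R}_0^+$ with $\{0\}\in\mathcal{E}$. Set functions have values in $\mathbb{R}_0^+$, vanish on $\emptyset$, and are not assumed additive or monotone unless stated. The family $\mathcal{A}$ is a $\sigma$-algebra of subsets of $T$ and $(\mu\varphi^{-1})(\emptyset)=0$. The definitions below are given for $(S,\mathcal{C},\mu)$ and are used in the same way for $(T,\mathcal{A},\mu\varphi^{-1})$. Measurability: $f:S\to\mathbb{R}_0^+$ is $\mu$-measurable if it is $\mathcal{C}$-measurable, i.e. $E_f^\alpha:=\{s\in S: f(s)\ge\alpha\}\in\mathcal{C}$ for all $\alpha\ge 0$. Riemann-Lebesgue (RL) integral: for two countable partitions $P,P'$ of $\mathbb{R}_0^+$, $P'$ is finer than $P$ if every set of $P'$ is included in some set of $P$. A function $h:\mathbb{R}_0^+\to\mathbb{R}$ is $\nu$-RL integrable if there is $a\in\mathbb{R}$ such that for every $\varepsilon>0$ there is a countable partition $\Pi_\varepsilon$ of $\mathbb{R}_0^+$ into sets of $\mathcal{E}$ such that for every countable partition $\Pi=(E_n)_n$ of $\mathbb{R}_0^+$ into sets of $\mathcal{E}$ finer than $\Pi_\varepsilon$: $h$ is bounded on every $E_n$ with $\nu(E_n)>0$, and for every choice of $s_n\in E_n$ the series $\sum_n h(s_n)\nu(E_n)$ converges absolutely and $|\sum_n h(s_n)\nu(E_n)-a|<\varepsilon$.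 Then $a$ is unique and is denoted $(RL)\int_{[0,\infty)}h\,d\nu$. Generalized decomposition integral: for a $\mu$-measurable $f:S\to\mathbb{R}_0^+$ and $A\in\mathcal{C}$ put $u_{f,\mu}^{A}(\alpha)=\mu(E_f^\alpha\cap A)$, $\alpha\ge 0$. $f$ is $(\nu,\mu)$-integrable on $A$ if $u_{f,\mu}^A$ is $\nu$-RL integrable on $\mathbb{R}_0^+$, and then $\int_A^{*}f\,d(\nu,\mu):=(RL)\int_{[0,\infty)}u_{f,\mu}^A\,d\nu$. $G_{RL}(\nu,\mu,A)$ is the set of all $\mu$-measurable $f:S\to\mathbb{R}_0^+$ that are $(\nu,\mu)$-integrable on $A$ (with finite integral). *)

theory Defs
  imports "HOL-Analysis.Analysis"
begin

text \<open>
  A measurable structure is given by an explicit carrier set, a \<open>\<sigma>\<close>-algebra on it and a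
  real-valued set function, of which only the values on the \<open>\<sigma>\<close>-algebra matter; no
  \<^typ>\<open>'a measure\<close> is used, since set functions need not be additive or monotone.
  The set \<open>\<real>\<^sub>0\<^sup>+\<close> is \<^term>\<open>{0..} :: real set\<close>.
\<close>

definition mu_measurable :: "'a set \<Rightarrow> 'a set set \<Rightarrow> ('a \<Rightarrow> real) \<Rightarrow> bool"
  where "mu_measurable S \<C> f \<longleftrightarrow> (\<forall>\<alpha>\<ge>0. {s\<in>S. f s \<ge> \<alpha>} \<in> \<C>)"

text \<open>
  Countable includes finite. A partition is a set of nonempty blocks, so the order of the
  blocks is immaterial; as the series below are required to converge absolutely, their sum is
  the unordered one, \<^const>\<open>infsum\<close>.
\<close>

definition countable_partition :: "real set set \<Rightarrow> real set set \<Rightarrow> bool"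
  where "countable_partition \<E> P \<longleftrightarrow> partition_on {0..} P \<and> countable P \<and> P \<subseteq> \<E>"

text \<open>A choice of points in the blocks is a function \<open>s\<close> with \<open>s E \<in> E\<close> for each block \<open>E\<close>.\<close>

definition has_RL_integral ::
    "real set set \<Rightarrow> (real set \<Rightarrow> real) \<Rightarrow> (real \<Rightarrow> real) \<Rightarrow> real \<Rightarrow> bool"
  where "has_RL_integral \<E> \<nu> h a \<longleftrightarrow>
    (\<forall>\<epsilon>>0. \<exists>P\<^sub>\<epsilon>. countable_partition \<E> P\<^sub>\<epsilon> \<and>
      (\<forall>P. countable_partition \<E> P \<and> refines {0..} P P\<^sub>\<epsilon> \<longrightarrow>
        (\<forall>E\<in>P. \<nu> E > 0 \<longrightarrow> bounded (h ` E)) \<and>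
        (\<forall>s\<in>(\<Pi> E\<in>P. E).
          (\<lambda>E. \<bar>h (s E) * \<nu> E\<bar>) summable_on P \<and>
          \<bar>(\<Sum>\<^sub>\<infinity>E\<in>P. h (s E) * \<nu> E) - a\<bar> < \<epsilon>)))"

definition RL_integrable :: "real set set \<Rightarrow> (real set \<Rightarrow> real) \<Rightarrow> (real \<Rightarrow> real) \<Rightarrow> bool"
  where "RL_integrable \<E> \<nu> h \<longleftrightarrow> (\<exists>a. has_RL_integral \<E> \<nu> h a)"

definition RL_integral :: "real set set \<Rightarrow> (real set \<Rightarrow> real) \<Rightarrow> (real \<Rightarrow> real) \<Rightarrow> real"
  where "RL_integral \<E> \<nu> h = (THE a. has_RL_integral \<E> \<nu> h a)"

lemma has_RL_integral_unique:
  assumes alg: "sigma_algebra {0..} \<E>"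
    and a: "has_RL_integral \<E> \<nu> h a" and b: "has_RL_integral \<E> \<nu> h b"
  shows "a = b"
proof (rule ccontr)
  assume "a \<noteq> b"
  define \<epsilon> where "\<epsilon> = \<bar>a - b\<bar> / 2"
  have "\<epsilon> > 0"
    using \<open>a \<noteq> b\<close> by (simp add: \<epsilon>_def)
  obtain P where P: "countable_partition \<E> P"
    and Pa: "\<And>R s. \<lbrakk>countable_partition \<E> R; refines {0..} R P; s \<in> (\<Pi> E\<in>R. E)\<rbrakk>
      \<Longrightarrow> \<bar>(\<Sum>\<^sub>\<infinity>E\<in>R. h (s E) * \<nu> E) - a\<bar> < \<epsilon>"
    using a \<open>\<epsilon> > 0\<close> unfolding has_RL_integral_def by meson
  obtain Q where Q: "countable_partition \<E> Q"
    and Qb: "\<And>R s. \<lbrakk>countable_partition \<E> R; refines {0..} R Q; s \<in> (\<Pi> E\<in>R. E)\<rbrakk>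
      \<Longrightarrow> \<bar>(\<Sum>\<^sub>\<infinity>E\<in>R. h (s E) * \<nu> E) - b\<bar> < \<epsilon>"
    using b \<open>\<epsilon> > 0\<close> unfolding has_RL_integral_def by meson
  define R where "R = (\<lambda>(A, B). A \<inter> B) ` (P \<times> Q) - {{}}"
  have "partition_on {0..} R"
  proof (rule partition_onI)
    have "\<Union>P = {0..}" "\<Union>Q = {0..}"
      using P Q unfolding countable_partition_def partition_on_def by simp_all
    moreover have "\<Union>R = \<Union>P \<inter> \<Union>Q"
      unfolding R_def by blast
    ultimately show "\<Union>R = {0..}"
      by simp
  next
    fix X Y
    assume "X \<in> R" "Y \<in> R" "X \<noteq> Y"
    then obtain A B A' B' where *: "X = A \<inter> B" "Y = A' \<inter> B'" "A \<in> P" "A' \<in> P" "B \<in> Q" "B' \<in> Q"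
      unfolding R_def by auto
    then have "A \<noteq> A' \<or> B \<noteq> B'"
      using \<open>X \<noteq> Y\<close> by auto
    then have "A \<inter> A' = {} \<or> B \<inter> B' = {}"
    proof
      assume "A \<noteq> A'"
      then show ?thesis
        using * P by (auto simp: countable_partition_def partition_on_def disjoint_def)
    next
      assume "B \<noteq> B'"
      then show ?thesis
        using * Q by (auto simp: countable_partition_def partition_on_def disjoint_def)
    qed
    then show "disjnt X Y"
      unfolding disjnt_def *(1,2) by auto
  next
    show "{} \<notin> R"
      by (simp add: R_def)
  qed
  moreover have "countable R"
    unfolding R_def using P Q by (intro countable_Diff countable_image countable_SIGMA)
      (simp_all add: countable_partition_def)
  moreover have "R \<subseteq> \<E>"
  proof -
    have "A \<inter> B \<in> \<E>" if "A \<in> \<E>" "B \<in> \<E>" for A B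
      using sigma_algebra.axioms(1)[OF alg] that by (simp add: algebra_iff_Int)
    moreover have "P \<subseteq> \<E>" "Q \<subseteq> \<E>"
      using P Q by (simp_all add: countable_partition_def)
    ultimately show ?thesis
      unfolding R_def by (auto simp: subset_iff)
  qed
  ultimately have R: "countable_partition \<E> R"
    by (simp add: countable_partition_def)
  have "\<forall>X\<in>R. \<exists>Y\<in>P. X \<subseteq> Y" "\<forall>X\<in>R. \<exists>Y\<in>Q. X \<subseteq> Y"
    by (auto simp: R_def)
  then have RP: "refines {0..} R P" and RQ: "refines {0..} R Q"
    using P Q R by (simp_all add: refines_def countable_partition_def)
  have s: "(\<lambda>E. SOME x. x \<in> E) \<in> (\<Pi> E\<in>R. E)"
    unfolding R_def by (intro Pi_I) (simp add: some_in_eq)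
  have "\<bar>a - b\<bar> < 2 * \<epsilon>"
    using Pa[OF R RP s] Qb[OF R RQ s] by linarith
  then show False
    by (simp add: \<epsilon>_def)
qed

text \<open>The decomposition integral on a structure \<open>(S, \<C>, \<mu>)\<close>, where \<open>A \<in> \<C>\<close>.\<close>

definition level_fun :: "'a set \<Rightarrow> ('a set \<Rightarrow> real) \<Rightarrow> 'a set \<Rightarrow> ('a \<Rightarrow> real) \<Rightarrow> real \<Rightarrow> real"
  where "level_fun S \<mu> A f \<alpha> = \<mu> ({s\<in>S. f s \<ge> \<alpha>} \<inter> A)"

definition decomp_integrable ::
    "real set set \<Rightarrow> (real set \<Rightarrow> real) \<Rightarrow> 'a set \<Rightarrow> ('a set \<Rightarrow> real) \<Rightarrow> 'a set \<Rightarrow> ('a \<Rightarrow> real) \<Rightarrow> bool"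
  where "decomp_integrable \<E> \<nu> S \<mu> A f \<longleftrightarrow> RL_integrable \<E> \<nu> (level_fun S \<mu> A f)"

definition decomp_integral ::
    "real set set \<Rightarrow> (real set \<Rightarrow> real) \<Rightarrow> 'a set \<Rightarrow> ('a set \<Rightarrow> real) \<Rightarrow> 'a set \<Rightarrow> ('a \<Rightarrow> real) \<Rightarrow> real"
  where "decomp_integral \<E> \<nu> S \<mu> A f = RL_integral \<E> \<nu> (level_fun S \<mu> A f)"

text \<open>
  Elements of \<open>G_RL\<close> are total functions, constrained only on the carrier \<open>S\<close>.
\<close>

definition G_RL ::
    "real set set \<Rightarrow> (real set \<Rightarrow> real) \<Rightarrow> 'a set \<Rightarrow> 'a set set \<Rightarrow> ('a set \<Rightarrow> real) \<Rightarrow> 'a set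
      \<Rightarrow> ('a \<Rightarrow> real) set"
  where "G_RL \<E> \<nu> S \<C> \<mu> A =
    {f \<in> S \<rightarrow> {0..}. mu_measurable S \<C> f \<and> decomp_integrable \<E> \<nu> S \<mu> A f}"

text \<open>The preimage of \<open>E\<close> under a map with domain \<open>S\<close> is \<^term>\<open>\<phi> -` E \<inter> S\<close>.\<close>

definition image_algebra :: "'a set \<Rightarrow> 'a set set \<Rightarrow> 'b set \<Rightarrow> ('a \<Rightarrow> 'b) \<Rightarrow> 'b set set"
  where "image_algebra S \<C> T \<phi> = {E. E \<subseteq> T \<and> \<phi> -` E \<inter> S \<in> \<C>}"

definition image_set_fun :: "'a set \<Rightarrow> ('a set \<Rightarrow> real) \<Rightarrow> ('a \<Rightarrow> 'b) \<Rightarrow> 'b set \<Rightarrow> real"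
  where "image_set_fun S \<mu> \<phi> E = \<mu> (\<phi> -` E \<inter> S)"

end

theory Submission
  imports Defs
begin

text \<open>The structure on \<open>T\<close> is pulled back along \<open>\<phi>\<close>, and
  pulling back a superlevel set of \<open>g\<close> gives the superlevel set of
  \<open>g \<circ> \<phi>\<close> at the same height. Hence measurability is the same condition on
  both sides (\<open>mu_measurable_image_algebra_iff\<close>), and the two level functions on the
  reals are equal (\<open>level_fun_image_set_fun\<close>). Integrability and integral depend on the
  integrand only through its level function, so they agree as well.\<close>

lemma vimage_superlevel:
  assumes "\<phi> \<in> S \<rightarrow> T"
  shows "\<phi> -` {t \<in> T. g t \<ge> \<alpha>} \<inter> S = {s \<in> S. (g \<circ> \<phi>) s \<ge> \<alpha>}"
  using assms by auto

text \<open>Membership in \<open>image_algebra\<close> is decided by the preimage, and a superlevel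
  set of \<open>g\<close> taken inside \<open>T\<close> is a subset of \<open>T\<close> by
  construction.\<close>

lemma mu_measurable_image_algebra_iff:
  assumes "\<phi> \<in> S \<rightarrow> T"
  shows "mu_measurable T (image_algebra S \<C> T \<phi>) g \<longleftrightarrow> mu_measurable S \<C> (g \<circ> \<phi>)"
proof -
  have "{t \<in> T. g t \<ge> \<alpha>} \<in> image_algebra S \<C> T \<phi> \<longleftrightarrow> {s \<in> S. (g \<circ> \<phi>) s \<ge> \<alpha>} \<in> \<C>" for \<alpha>
    unfolding image_algebra_def mem_Collect_eq vimage_superlevel[OF assms] by blast
  then show ?thesis
    by (simp add: mu_measurable_def)
qed

text \<open>At each height both sides evaluate \<open>\<mu>\<close> at the same subset of
  \<open>S\<close>. Equality as functions lets integrability and integral transfer by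
  rewriting.\<close>

lemma level_fun_image_set_fun:
  assumes "\<phi> \<in> S \<rightarrow> T"
  shows "level_fun T (image_set_fun S \<mu> \<phi>) T g = level_fun S \<mu> S (g \<circ> \<phi>)"
proof
  fix \<alpha>
  \<comment> \<open>The set of integration is the whole carrier, so the intersection in
    \<open>level_fun\<close> is absorbed; this exposes the form that
    \<open>vimage_superlevel\<close> rewrites.\<close>
  have "{t \<in> T. g t \<ge> \<alpha>} \<inter> T = {t \<in> T. g t \<ge> \<alpha>}"
    and "{s \<in> S. (g \<circ> \<phi>) s \<ge> \<alpha>} \<inter> S = {s \<in> S. (g \<circ> \<phi>) s \<ge> \<alpha>}"
    by blast+
  then show "level_fun T (image_set_fun S \<mu> \<phi>) T g \<alpha> = level_fun S \<mu> S (g \<circ> \<phi>) \<alpha>"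
    by (simp only: level_fun_def image_set_fun_def vimage_superlevel[OF assms])
qed

theorem theorem3p21:
  fixes S :: "'a set" and \<C> :: "'a set set" and \<mu> :: "'a set \<Rightarrow> real"
    and \<E> :: "real set set" and \<nu> :: "real set \<Rightarrow> real"
    and T :: "'b set" and \<phi> :: "'a \<Rightarrow> 'b" and g :: "'b \<Rightarrow> real"
  assumes "S \<noteq> {}" and "infinite S" and "sigma_algebra S \<C>"
    and "sigma_algebra {0..} \<E>" and "{0} \<in> \<E>"
    and "\<And>A. A \<in> \<C> \<Longrightarrow> 0 \<le> \<mu> A" and "\<mu> {} = 0"
    and "\<And>B. B \<in> \<E> \<Longrightarrow> 0 \<le> \<nu> B" and "\<nu> {} = 0"
    and "T \<noteq> {}" and "\<phi> \<in> S \<rightarrow> T"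
    and "g \<in> T \<rightarrow> {0..}"
  shows "(g \<in> G_RL \<E> \<nu> T (image_algebra S \<C> T \<phi>) (image_set_fun S \<mu> \<phi>) T
            \<longleftrightarrow> g \<circ> \<phi> \<in> G_RL \<E> \<nu> S \<C> \<mu> S)
       \<and> (g \<in> G_RL \<E> \<nu> T (image_algebra S \<C> T \<phi>) (image_set_fun S \<mu> \<phi>) T
            \<longrightarrow> decomp_integral \<E> \<nu> T (image_set_fun S \<mu> \<phi>) T g
                = decomp_integral \<E> \<nu> S \<mu> S (g \<circ> \<phi>))"
proof -
  have "g \<circ> \<phi> \<in> S \<rightarrow> {0..}"
    using \<open>\<phi> \<in> S \<rightarrow> T\<close> \<open>g \<in> T \<rightarrow> {0..}\<close> by auto
  with \<open>g \<in> T \<rightarrow> {0..}\<close> show ?thesis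
    \<comment> \<open>With both range conditions known to hold, the rewriting makes the two sides of
      the equivalence, and of the integral equation, syntactically identical.\<close>
    by (simp only: G_RL_def decomp_integrable_def decomp_integral_def mem_Collect_eq simp_thms
        mu_measurable_image_algebra_iff[OF \<open>\<phi> \<in> S \<rightarrow> T\<close>] level_fun_image_set_fun[OF \<open>\<phi> \<in> S \<rightarrow> T\<close>])
qed

end
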